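(* Let $n\ge 2$ and $m\ge n-1$ be integers. Let $S\in\mathcal{T}(n,m)$ be the weighted star $K_{1,n-1}$ whose $n-1$ edge weights are as equal as possible, and let $T\in\mathcal{T}(n,m)$ be any weighted tree with $T\neq S$ as weighted graphs. Then $S\prec T$, and hence $\mathbb{E}(S)<\mathbb{E}(T)$.
   Context: $\mathcal{T}(n,m)$ denotes the set of trees on $n$ vertices in which every edge has a positive integer weight and the sum of all edge weights equals $m$. For a weighted graph $G$ its weighted adjacency matrix $A(G)$ has $(i,j)$ entry equal to the weight of edge $ij$ (and $0$ if $ij$ is not an edge); the energy is $\mathbb{E}(G)=\sum_{i=1}^n|\lambda_i|$ where $\lambda_i$ are the eigenvalues of $A(G)$. For a weighted bipartite graph $G$ of order $n$, $b_k(G)$ is the sum, over all matchings of $G$ with $k$ edges, of the product of the squares of the weights of the edges of the matching ($b_0(G)=1$). For weighted bipartite graphs $G_1,G_2$ of order $n$, $G_1\preceq G_2$ means $b_k(G_1)\le b_k(G_2)$ for all $1\le k\le\lfloor n/2\rfloor$, and $G_1\prec G_2$ means $G_1\preceq G_2$ with strict inequality for at least one $k$. Positive integers $a_1,\dots,a_k$ with sum $m$ are "as equal as possible" if each $a_i$ equals $r$ or $r+1$, where $r=\lfloor m/k\rfloor$. A star $K_{1,p}$ is a tree on $p+1$ vertices with one vertex adjacent to all others. *)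

theory Defs
  imports "Jordan_Normal_Form.Spectral_Radius"
begin

text \<open>
  Finite simple undirected graphs on the vertices \<open>0, \<dots>, nverts G - 1\<close>, with a weight on each edge.
  The values of \<open>weight\<close> outside \<open>edges\<close> are irrelevant.
\<close>

record wgraph =
  nverts :: nat
  edges :: "nat set set"
  weight :: "nat set \<Rightarrow> nat"

definition wf_wgraph :: "wgraph \<Rightarrow> bool" where
  "wf_wgraph G \<longleftrightarrow>
    edges G \<subseteq> {{u, v} | u v. u < nverts G \<and> v < nverts G \<and> u \<noteq> v} \<and>
    (\<forall>e\<in>edges G. weight G e > 0)"

definition wgraph_connected :: "wgraph \<Rightarrow> bool" where
  "wgraph_connected G \<longleftrightarrow>
    (\<forall>u<nverts G. \<forall>v<nverts G. (u, v) \<in> {(x, y). {x, y} \<in> edges G}\<^sup>*)"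

definition wgraph_cycle :: "wgraph \<Rightarrow> nat list \<Rightarrow> bool" where
  "wgraph_cycle G p \<longleftrightarrow>
    length p \<ge> 3 \<and> distinct p \<and>
    (\<forall>i<length p. {p ! i, p ! ((i + 1) mod length p)} \<in> edges G)"

text \<open>
  \<open>Graph_Theory\<close> has a notion of tree, but for digraphs: there a pair of opposite arcs already
  counts as a cycle, so it cannot be applied to the symmetric digraph of an undirected graph.
\<close>

definition wtree :: "wgraph \<Rightarrow> bool" where
  "wtree G \<longleftrightarrow> wf_wgraph G \<and> nverts G > 0 \<and> wgraph_connected G \<and> \<not> (\<exists>p. wgraph_cycle G p)"

definition wtrees :: "nat \<Rightarrow> nat \<Rightarrow> wgraph set" where
  "wtrees n m = {G. wtree G \<and> nverts G = n \<and> (\<Sum>e\<in>edges G. weight G e) = m}"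

definition is_star :: "wgraph \<Rightarrow> bool" where
  "is_star G \<longleftrightarrow>
    (\<exists>c<nverts G. edges G = {{c, v} | v. v < nverts G \<and> v \<noteq> c})"

definition as_equal_as_possible :: "('a \<Rightarrow> nat) \<Rightarrow> 'a set \<Rightarrow> bool" where
  "as_equal_as_possible a I \<longleftrightarrow>
    (let r = (\<Sum>i\<in>I. a i) div card I in \<forall>i\<in>I. a i = r \<or> a i = r + 1)"

definition wgraph_iso :: "wgraph \<Rightarrow> wgraph \<Rightarrow> bool" where
  "wgraph_iso G H \<longleftrightarrow>
    (\<exists>f. bij_betw f {..<nverts G} {..<nverts H} \<and>
         (\<lambda>e. f ` e) ` edges G = edges H \<and>
         (\<forall>e\<in>edges G. weight H (f ` e) = weight G e))"

definition adj_matrix :: "wgraph \<Rightarrow> real mat" where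
  "adj_matrix G = mat (nverts G) (nverts G)
    (\<lambda>(i, j). if {i, j} \<in> edges G then real (weight G {i, j}) else 0)"

text \<open>
  The eigenvalues are taken over the complex numbers and with algebraic multiplicity, so
  that there are exactly \<open>nverts G\<close> of them by definition.
\<close>

definition energy :: "wgraph \<Rightarrow> real" where
  "energy G = (let A = map_mat complex_of_real (adj_matrix G) in
    \<Sum>x\<in>spectrum A. real (Polynomial.order x (char_poly A)) * cmod x)"

definition k_matchings :: "wgraph \<Rightarrow> nat \<Rightarrow> nat set set set" where
  "k_matchings G k = {M. M \<subseteq> edges G \<and> card M = k \<and> pairwise disjnt M}"

definition b_coeff :: "nat \<Rightarrow> wgraph \<Rightarrow> nat" where
  "b_coeff k G = (\<Sum>M\<in>k_matchings G k. \<Prod>e\<in>M. (weight G e)\<^sup>2)"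

text \<open>The two relations compare graphs of the same order only.\<close>

definition b_le :: "wgraph \<Rightarrow> wgraph \<Rightarrow> bool" (infix \<open>\<preceq>\<^sub>b\<close> 50) where
  "G \<preceq>\<^sub>b H \<longleftrightarrow> nverts G = nverts H \<and> (\<forall>k\<in>{1..nverts G div 2}. b_coeff k G \<le> b_coeff k H)"

definition b_less :: "wgraph \<Rightarrow> wgraph \<Rightarrow> bool" (infix \<open>\<prec>\<^sub>b\<close> 50) where
  "G \<prec>\<^sub>b H \<longleftrightarrow> G \<preceq>\<^sub>b H \<and> (\<exists>k\<in>{1..nverts G div 2}. b_coeff k G < b_coeff k H)"

end

theory Submission
  imports Defs
begin

text \<open>
  A star has no two disjoint edges, so \<open>b\<^sub>k(S) = 0\<close> for \<open>k \<ge> 2\<close>, while \<open>b\<^sub>1\<close> is the sum of the squared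
  edge weights. With \<open>r = \<lfloor>m / (n - 1)\<rfloor>\<close>, summing \<open>(w - r) (w - r - 1) \<ge> 0\<close> over the edges shows that
  \<open>b\<^sub>1\<close> is minimal exactly for balanced weights. A tree that is not a star has two disjoint edges,
  hence \<open>b\<^sub>2 > 0\<close>.

  For the energy, the Coulson integral formula is avoided. In an acyclic graph the fourth moment of
  the spectrum is \<open>2 b\<^sub>1\<^sup>2 - 4 b\<^sub>2\<close>, and the second moment is \<open>2 b\<^sub>1\<close>. Together they force the energy to
  be at least \<open>2 \<surd>b\<^sub>1\<close>, and strictly larger if \<open>b\<^sub>2 > 0\<close>; for a star the energy equals \<open>2 \<surd>b\<^sub>1\<close>.
\<close>

section \<open>Traces and eigenvalues\<close>

lemma mult_mat_index_sum:
  "A \<in> carrier_mat n m \<Longrightarrow> B \<in> carrier_mat m l \<Longrightarrow> i < n \<Longrightarrow> j < l \<Longrightarrow>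
    (A * B) $$ (i, j) = (\<Sum>k<m. A $$ (i, k) * B $$ (k, j))"
  by (auto simp: scalar_prod_def atLeast0LessThan)

lemma trace_mult_commute:
  fixes A B :: "'a :: comm_semiring_0 mat"
  assumes "A \<in> carrier_mat n m" "B \<in> carrier_mat m n"
  shows "(\<Sum>i<n. (A * B) $$ (i, i)) = (\<Sum>i<m. (B * A) $$ (i, i))"
proof -
  have "(\<Sum>i<n. (A * B) $$ (i, i)) = (\<Sum>i<n. \<Sum>j<m. A $$ (i, j) * B $$ (j, i))"
    using assms by (intro sum.cong) (auto simp: scalar_prod_def atLeast0LessThan)
  also have "\<dots> = (\<Sum>j<m. \<Sum>i<n. B $$ (j, i) * A $$ (i, j))"
    by (subst sum.swap) (simp add: mult.commute)
  also have "\<dots> = (\<Sum>i<m. (B * A) $$ (i, i))"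
    using assms by (intro sum.cong) (auto simp: scalar_prod_def atLeast0LessThan)
  finally show ?thesis .
qed

text \<open>A nonzero term \<open>A $$ (i, k) * B $$ (k, j)\<close> requires i \<le> k \<le> j.
  Below the diagonal no such k exists, and on the diagonal only k = i remains.\<close>

lemma upper_triangular_mult:
  fixes A B :: "'a :: semiring_0 mat"
  assumes "A \<in> carrier_mat n n" "B \<in> carrier_mat n n" "upper_triangular A" "upper_triangular B"
  shows "upper_triangular (A * B)"
    and "i < n \<Longrightarrow> (A * B) $$ (i, i) = A $$ (i, i) * B $$ (i, i)"
proof -
  have z: "A $$ (i, k) * B $$ (k, j) = 0" if "j \<le> i" "i < n" "k < n" "k \<noteq> i \<or> k \<noteq> j" for i j k
    using that assms upper_triangularD[of A k i] upper_triangularD[of B j k]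
    by (cases "k < i") auto
  show "upper_triangular (A * B)"
    using assms(1,2) z by (auto simp: scalar_prod_def intro!: sum.neutral)
  show "(A * B) $$ (i, i) = A $$ (i, i) * B $$ (i, i)" if "i < n"
  proof -
    have "(A * B) $$ (i, i) = (\<Sum>k\<in>{0..<n}. A $$ (i, k) * B $$ (k, i))"
      using assms that by (auto simp: scalar_prod_def)
    also have "\<dots> = (\<Sum>k\<in>{i}. A $$ (i, k) * B $$ (k, i))"
      using that z[of i i] by (intro sum.mono_neutral_right) auto
    finally show ?thesis by simp
  qed
qed

lemma upper_triangular_pow:
  fixes A :: "'a :: comm_semiring_1 mat"
  assumes "A \<in> carrier_mat n n" "upper_triangular A"
  shows "upper_triangular (A ^\<^sub>m k) \<and> (\<forall>i<n. (A ^\<^sub>m k) $$ (i, i) = A $$ (i, i) ^ k)"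
proof (induction k)
  case 0
  then show ?case using assms by (auto simp: upper_triangular_def)
next
  case (Suc k)
  then show ?case
    using upper_triangular_mult[of "A ^\<^sub>m k" n A] assms by (auto simp: mult.commute)
qed

text \<open>Schur decomposition: A is similar to an upper triangular matrix with \<open>as\<close>
  on its diagonal. The trace is invariant under cyclic shifts, and powers of a triangular matrix
  have the powers of its diagonal on theirs.\<close>

lemma trace_pow_eq_sum_eigenvalues:
  fixes A :: "complex mat"
  assumes A: "A \<in> carrier_mat n n" and cp: "char_poly A = (\<Prod>a\<leftarrow>as. [:- a, 1:])"
  shows "(\<Sum>i<n. (A ^\<^sub>m k) $$ (i, i)) = (\<Sum>a\<leftarrow>as. a ^ k)"
proof -
  obtain B P Q where "schur_decomposition A as = (B, P, Q)"
    by (cases "schur_decomposition A as") auto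
  from schur_decomposition[OF A cp this]
  have wit: "similar_mat_wit A B P Q" and ut: "upper_triangular B" and diag: "diag_mat B = as"
    by auto
  from similar_mat_witD2[OF A wit] have
    B: "B \<in> carrier_mat n n" and P: "P \<in> carrier_mat n n" and Q: "Q \<in> carrier_mat n n"
    and QP: "Q * P = 1\<^sub>m n" by auto
  have Bk: "B ^\<^sub>m k \<in> carrier_mat n n" using B by simp
  have "(\<Sum>i<n. (A ^\<^sub>m k) $$ (i, i)) = (\<Sum>i<n. ((P * B ^\<^sub>m k) * Q) $$ (i, i))"
    by (simp add: similar_mat_wit_pow_id[OF wit])
  also have "\<dots> = (\<Sum>i<n. (Q * (P * B ^\<^sub>m k)) $$ (i, i))"
    using P Q Bk by (intro trace_mult_commute) auto
  also have "Q * (P * B ^\<^sub>m k) = B ^\<^sub>m k"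
    using assoc_mult_mat[OF Q P Bk] left_mult_one_mat[OF Bk] QP by simp
  also have "(\<Sum>i<n. (B ^\<^sub>m k) $$ (i, i)) = (\<Sum>i<n. B $$ (i, i) ^ k)"
    using upper_triangular_pow[OF B ut, of k] by simp
  also have "\<dots> = (\<Sum>a\<leftarrow>as. a ^ k)"
    using B by (simp add: diag[symmetric] diag_mat_def sum_list_sum_nth atLeast0LessThan)
  finally show ?thesis .
qed

lemma order_prod_linear_factors:
  "Polynomial.order x (\<Prod>a\<leftarrow>as. [:- a, 1:]) = count_list as (x :: complex)"
proof (induction as)
  case Nil
  then show ?case by (simp add: order_0I)
next
  case (Cons a as)
  have "(\<Prod>a\<leftarrow>as. [:- a, 1:]) \<noteq> 0" by (auto simp: prod_list_zero_iff)
  then have "[:- a, 1:] * (\<Prod>a\<leftarrow>as. [:- a, 1:]) \<noteq> 0"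
    by (metis mult_eq_0_iff one_neq_zero pCons_eq_0_iff)
  from order_mult[OF this, of x] Cons show ?case
    using order_linear'[of x "- a"] by auto
qed

text \<open>Turns the sum over distinct eigenvalues with multiplicities, as in
  \<open>energy\<close>, into a sum over the list of all roots of the characteristic
  polynomial.\<close>

lemma sum_count_list_mult:
  fixes f :: "'a \<Rightarrow> 'b :: semiring_1"
  shows "(\<Sum>x\<in>set as. of_nat (count_list as x) * f x) = (\<Sum>a\<leftarrow>as. f a)"
proof -
  \<comment> \<open>The index set is enlarged to a fixed X so that it stays the same while the list
    grows in the induction.\<close>
  have "(\<Sum>x\<in>X. of_nat (count_list as x) * f x) = (\<Sum>a\<leftarrow>as. f a)"
    if "finite X" "set as \<subseteq> X" for X
    using that
  proof (induction as)
    case (Cons a as)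
    have "(\<Sum>x\<in>X. of_nat (count_list (a # as) x) * f x) =
        (\<Sum>x\<in>X. (if a = x then f x else 0) + of_nat (count_list as x) * f x)"
      by (intro sum.cong) (auto simp: algebra_simps)
    then show ?case using Cons by (simp add: sum.distrib)
  qed simp
  then show ?thesis by simp
qed

lemma spectrum_factorized:
  assumes A: "A \<in> carrier_mat n n" and cp: "char_poly A = (\<Prod>a\<leftarrow>as. [:- a, 1:])"
  shows "spectrum A = set (as :: complex list)"
proof -
  have "poly (\<Prod>a\<leftarrow>as. [:- a, 1:]) x = 0 \<longleftrightarrow> x \<in> set as" for x
    by (induction as) auto
  then show ?thesis using spectrum_root_char_poly[OF A] cp by auto
qed

text \<open>For an eigenvector v the Hermitian form \<open>q\<close> equals x times the squared norm
  \<open>N\<close> of v. By symmetry of A it is its own conjugate, so x is too.\<close>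

lemma real_symmetric_eigenvalue_real:
  assumes A: "A \<in> carrier_mat n n" and sym: "\<And>i j. i < n \<Longrightarrow> j < n \<Longrightarrow> A $$ (i, j) = A $$ (j, i)"
    and ev: "eigenvalue (map_mat complex_of_real A) x"
  shows "x \<in> \<real>"
proof -
  let ?A = "map_mat complex_of_real A"
  from ev obtain v where v: "v \<in> carrier_vec n" "v \<noteq> 0\<^sub>v n" "?A *\<^sub>v v = x \<cdot>\<^sub>v v"
    using A unfolding eigenvalue_def eigenvector_def by auto
  have row: "(\<Sum>j<n. of_real (A $$ (i, j)) * v $ j) = x * v $ i" if "i < n" for i
  proof -
    have "(\<Sum>j<n. of_real (A $$ (i, j)) * v $ j) = (?A *\<^sub>v v) $ i"
      using that v(1) A by (simp add: scalar_prod_def atLeast0LessThan)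
    then show ?thesis using that v by simp
  qed
  define N where "N = (\<Sum>i<n. (cmod (v $ i))\<^sup>2)"
  define q where "q = (\<Sum>i<n. \<Sum>j<n. cnj (v $ i) * of_real (A $$ (i, j)) * v $ j)"
  have "q = (\<Sum>i<n. cnj (v $ i) * (x * v $ i))"
    unfolding q_def by (intro sum.cong refl) (simp add: row[symmetric] sum_distrib_left mult.assoc)
  also have "\<dots> = x * of_real N"
    unfolding N_def of_real_sum sum_distrib_left
    by (intro sum.cong refl) (simp add: complex_norm_square mult_ac del: of_real_power)
  finally have q: "q = x * of_real N" .
  have "cnj q = (\<Sum>i<n. \<Sum>j<n. cnj (v $ j) * of_real (A $$ (i, j)) * v $ i)"
    unfolding q_def by (simp add: mult_ac)
  also have "\<dots> = q"
    unfolding q_def by (subst sum.swap) (auto intro!: sum.cong simp: sym)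
  finally have "cnj q = q" .
  moreover have "N \<noteq> 0"
  proof
    assume "N = 0"
    then have "\<forall>i<n. v $ i = 0" unfolding N_def by (subst (asm) sum_nonneg_eq_0_iff) auto
    then have "v = 0\<^sub>v n" using v(1) by auto
    with v(2) show False by simp
  qed
  ultimately have "cnj x = x" using q by simp
  then show ?thesis by (simp add: Reals_cnj_iff)
qed

section \<open>Spectral moments of the adjacency matrix\<close>

definition adj :: "wgraph \<Rightarrow> nat \<Rightarrow> nat \<Rightarrow> real" where
  "adj G i j = (if {i, j} \<in> edges G then real (weight G {i, j}) else 0)"

lemma adj_commute: "adj G i j = adj G j i"
  by (simp add: adj_def insert_commute)

lemma adj_matrix_carrier: "adj_matrix G \<in> carrier_mat (nverts G) (nverts G)"
  by (simp add: adj_matrix_def)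

lemma adj_matrix_index:
  "i < nverts G \<Longrightarrow> j < nverts G \<Longrightarrow> adj_matrix G $$ (i, j) = adj G i j"
  by (simp add: adj_matrix_def adj_def)

lemma adj_matrix_square_index:
  "i < nverts G \<Longrightarrow> j < nverts G \<Longrightarrow>
    (adj_matrix G * adj_matrix G) $$ (i, j) = (\<Sum>k<nverts G. adj G i k * adj G k j)"
  by (simp add: mult_mat_index_sum[OF adj_matrix_carrier adj_matrix_carrier] adj_matrix_index)

text \<open>The square of the adjacency matrix is symmetric, so the trace of the square of that
  matrix is the sum of its squared entries.\<close>

lemma adj_matrix_fourth_power_trace:
  "(\<Sum>i<nverts G. (adj_matrix G ^\<^sub>m 4) $$ (i, i)) =
    (\<Sum>i<nverts G. \<Sum>j<nverts G. (\<Sum>k<nverts G. adj G i k * adj G k j)\<^sup>2)"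
proof -
  let ?A = "adj_matrix G"
  note A = adj_matrix_carrier[of G]
  have sq: "?A * ?A \<in> carrier_mat (nverts G) (nverts G)" using A by simp
  have "?A ^\<^sub>m 4 = (?A * ?A) * (?A * ?A)"
    using A by (simp add: numeral_eq_Suc assoc_mult_mat[of _ "nverts G" "nverts G" _ "nverts G" _ "nverts G"])
  then have "(?A ^\<^sub>m 4) $$ (i, i) = (\<Sum>j<nverts G. (\<Sum>k<nverts G. adj G i k * adj G k j)\<^sup>2)"
    if "i < nverts G" for i
    using that mult_mat_index_sum[OF sq sq, of i i]
    by (simp add: adj_matrix_square_index power2_eq_square adj_commute mult.commute del: index_mult_mat(1))
  then show ?thesis by simp
qed

text \<open>Collects all spectral information used below: a real list of eigenvalues with
  multiplicity whose absolute values sum to the energy and whose second and fourth moments are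
  traces.\<close>

lemma energy_real_spectrum:
  obtains ls where "energy G = (\<Sum>l\<leftarrow>ls. \<bar>l\<bar>)"
    and "(\<Sum>l\<leftarrow>ls. l\<^sup>2) = (\<Sum>i<nverts G. \<Sum>j<nverts G. (adj G i j)\<^sup>2)"
    and "(\<Sum>l\<leftarrow>ls. l ^ 4) =
      (\<Sum>i<nverts G. \<Sum>j<nverts G. (\<Sum>k<nverts G. adj G i k * adj G k j)\<^sup>2)"
    and "\<And>l. l \<in> set ls \<Longrightarrow> eigenvalue (map_mat complex_of_real (adj_matrix G)) (of_real l)"
proof -
  let ?A = "adj_matrix G" and ?n = "nverts G"
  let ?C = "map_mat complex_of_real ?A"
  note A = adj_matrix_carrier[of G]
  have C: "?C \<in> carrier_mat ?n ?n" using A by simp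
  from char_poly_factorized[OF C] obtain as where cp: "char_poly ?C = (\<Prod>a\<leftarrow>as. [:- a, 1:])"
    by blast
  note spec = spectrum_factorized[OF C cp]
  have ev: "eigenvalue ?C a" if "a \<in> set as" for a
    using that spec by (auto simp: spectrum_def)
  have re: "a \<in> \<real>" if "a \<in> set as" for a
    using real_symmetric_eigenvalue_real[OF A _ ev[OF that]]
    by (simp add: adj_matrix_index adj_commute)
  define ls where "ls = map Re as"
  have as: "as = map of_real ls"
    unfolding ls_def map_map by (rule map_idI[symmetric]) (use re in \<open>auto elim!: Reals_cases\<close>)
  have "energy G = (\<Sum>a\<leftarrow>as. cmod a)"
    unfolding energy_def Let_def cp order_prod_linear_factors spec
    by (rule sum_count_list_mult)
  also have "\<dots> = (\<Sum>l\<leftarrow>ls. \<bar>l\<bar>)" by (simp add: as o_def)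
  finally have energy: "energy G = (\<Sum>l\<leftarrow>ls. \<bar>l\<bar>)" .
  have tr: "(\<Sum>l\<leftarrow>ls. l ^ k) = (\<Sum>i<?n. (?A ^\<^sub>m k) $$ (i, i))" for k
  proof -
    have "complex_of_real (\<Sum>l\<leftarrow>ls. l ^ k) = (\<Sum>a\<leftarrow>as. a ^ k)"
      unfolding as by (induction ls) auto
    also have "\<dots> = (\<Sum>i<?n. (?C ^\<^sub>m k) $$ (i, i))"
      by (rule trace_pow_eq_sum_eigenvalues[OF C cp, symmetric])
    also have "?C ^\<^sub>m k = map_mat complex_of_real (?A ^\<^sub>m k)"
      by (simp add: of_real_hom.mat_hom_pow[OF A])
    also have "(\<Sum>i<?n. map_mat complex_of_real (?A ^\<^sub>m k) $$ (i, i)) =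
        complex_of_real (\<Sum>i<?n. (?A ^\<^sub>m k) $$ (i, i))"
      using A by (auto intro!: sum.cong)
    finally show ?thesis by (simp only: of_real_eq_iff)
  qed
  have "(?A ^\<^sub>m 2) $$ (i, i) = (\<Sum>j<?n. (adj G i j)\<^sup>2)" if "i < ?n" for i
    using adj_matrix_square_index[OF that that] A
    by (simp add: numeral_eq_Suc adj_commute power2_eq_square del: index_mult_mat(1))
  then have "(\<Sum>l\<leftarrow>ls. l\<^sup>2) = (\<Sum>i<?n. \<Sum>j<?n. (adj G i j)\<^sup>2)" by (simp add: tr)
  moreover have "eigenvalue ?C (of_real l)" if "l \<in> set ls" for l
    by (rule ev) (use that as in auto)
  ultimately show ?thesis using that energy tr[of 4] adj_matrix_fourth_power_trace by metis
qed

section \<open>Trees and matchings\<close>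

lemma wf_wgraph_edgeE:
  assumes "wf_wgraph G" "e \<in> edges G"
  obtains u v where "e = {u, v}" "u < nverts G" "v < nverts G" "u \<noteq> v"
  using assms unfolding wf_wgraph_def by blast

lemma wf_wgraph_edge_iff:
  assumes "wf_wgraph G" "{u, v} \<in> edges G"
  shows "u < nverts G" "v < nverts G" "u \<noteq> v"
  using wf_wgraph_edgeE[OF assms] by (auto simp: doubleton_eq_iff)

lemma wf_wgraph_edge_atE:
  assumes "wf_wgraph G" "e \<in> edges G" "u \<in> e"
  obtains v where "e = {u, v}" "u < nverts G" "v < nverts G" "u \<noteq> v"
proof -
  obtain a b where "e = {a, b}" "a < nverts G" "b < nverts G" "a \<noteq> b"
    by (rule wf_wgraph_edgeE[OF assms(1,2)])
  then show ?thesis using that[of a] that[of b] assms(3) by (auto simp: insert_commute)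
qed

lemma finite_edges:
  assumes "wf_wgraph G"
  shows "finite (edges G)"
proof (rule finite_subset)
  show "edges G \<subseteq> Pow {..<nverts G}"
    using wf_wgraph_edgeE[OF assms] by blast
qed simp

text \<open>An end of a longest path has at most one incident edge. The edge set E and the vertex
  set V are arbitrary, so that the result still applies after vertices have been deleted.\<close>

lemma acyclic_exists_leaf:
  assumes acyclic: "\<nexists>p. wgraph_cycle G p" and E: "E \<subseteq> edges G"
    and V: "finite V" "V \<noteq> {}" "E \<subseteq> {{u, v} | u v. u \<in> V \<and> v \<in> V \<and> u \<noteq> v}"
  shows "\<exists>v\<in>V. \<exists>f. {e \<in> E. v \<in> e} \<subseteq> {f}"
proof -
  define P where "P p \<longleftrightarrow> p \<noteq> [] \<and> distinct p \<and> set p \<subseteq> V \<and>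
    (\<forall>i. Suc i < length p \<longrightarrow> {p ! i, p ! Suc i} \<in> E)" for p
  from V obtain v0 where "v0 \<in> V" by blast
  then have "P [v0]" by (simp add: P_def)
  moreover have "length p \<le> card V" if "P p" for p
    using that V(1) by (metis P_def card_mono distinct_card)
  ultimately obtain p where p: "P p" and max: "\<And>q. P q \<Longrightarrow> length q \<le> length p"
    using ex_has_greatest_nat[of P "[v0]" length "Suc (card V)"]
    by (auto simp: less_Suc_eq_le)
  \<comment> \<open>By maximality the neighbours of the first vertex lie on the path, by acyclicity only at index 1.\<close>
  have "e = {p ! 0, p ! 1}" if e: "e \<in> E" "p ! 0 \<in> e" for e
  proof -
    from e(1) V(3) obtain u w where "e = {u, w}" "u \<in> V" "w \<in> V" "u \<noteq> w" by blast
    with e(2) obtain w where w: "e = {p ! 0, w}" "w \<in> V" "w \<noteq> p ! 0" by blast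
    have "w \<in> set p"
    proof (rule ccontr)
      assume "w \<notin> set p"
      then have "P (w # p)"
        using p w e unfolding P_def by (auto simp: nth_Cons insert_commute split: nat.splits)
      from max[OF this] show False by simp
    qed
    then obtain j where j: "j < length p" "w = p ! j" by (metis in_set_conv_nth)
    have "j = 1"
    proof (rule ccontr)
      assume "j \<noteq> 1"
      with j w have j2: "j \<ge> 2" by (cases j; cases "j - 1") auto
      \<comment> \<open>The edge \<open>e\<close> leads from index j back to index 0 and closes the
        initial segment of the path; j \<ge> 2 gives it at least three vertices.\<close>
      have "wgraph_cycle G (take (Suc j) p)"
        unfolding wgraph_cycle_def
      proof (intro conjI allI impI)
        show "3 \<le> length (take (Suc j) p)" using j j2 by simp
        show "distinct (take (Suc j) p)" using p by (simp add: P_def)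
        fix i assume "i < length (take (Suc j) p)"
        then consider "i < j" | "i = j" using j by fastforce
        then show "{take (Suc j) p ! i, take (Suc j) p ! ((i + 1) mod length (take (Suc j) p))} \<in> edges G"
        proof cases
          case 1
          then show ?thesis using p j E unfolding P_def by (auto simp: min_def)
        next
          case 2
          moreover have "length (take (Suc j) p) = Suc j" using j by simp
          ultimately show ?thesis using w j e E by (auto simp: insert_commute)
        qed
      qed
      with acyclic show False by blast
    qed
    with w j show ?thesis by simp
  qed
  then have "{e \<in> E. p ! 0 \<in> e} \<subseteq> {{p ! 0, p ! 1}}" by auto
  moreover have "p ! 0 \<in> V" using p unfolding P_def by (auto intro: nth_mem)
  ultimately show ?thesis by blast
qed

text \<open>Induction on the number of vertices: deleting a vertex with at most one incident edge
  removes at most one edge.\<close>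

lemma acyclic_card_edges_less:
  assumes "\<nexists>p. wgraph_cycle G p" "E \<subseteq> edges G"
    and "finite V" "V \<noteq> {}" "E \<subseteq> {{u, v} | u v. u \<in> V \<and> v \<in> V \<and> u \<noteq> v}"
  shows "finite E \<and> card E < card V"
  using assms(2-)
proof (induction "card V" arbitrary: V E rule: less_induct)
  case less
  from acyclic_exists_leaf[OF assms(1) less.prems]
  obtain v f where v: "v \<in> V" "{e \<in> E. v \<in> e} \<subseteq> {f}" by blast
  define E' where "E' = {e \<in> E. v \<notin> e}"
  have sub: "E \<subseteq> insert f E'" using v by (auto simp: E'_def)
  have E': "E' \<subseteq> {{u, w} | u w. u \<in> V - {v} \<and> w \<in> V - {v} \<and> u \<noteq> w}"
  proof
    fix e assume "e \<in> E'"
    then have "e \<in> E" "v \<notin> e" by (auto simp: E'_def)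
    with less.prems(4) show "e \<in> {{u, w} | u w. u \<in> V - {v} \<and> w \<in> V - {v} \<and> u \<noteq> w}" by blast
  qed
  show ?case
  \<comment> \<open>The induction hypothesis speaks of nonempty vertex sets only. A single vertex
    carries no edge, as edges have distinct ends.\<close>
  proof (cases "V = {v}")
    case True
    then have "E = {}" using less.prems(4) by auto
    then show ?thesis using True by simp
  next
    case False
    then have "V - {v} \<noteq> {}" using v by blast
    moreover have "card (V - {v}) < card V"
      using v less.prems(2) by (intro psubset_card_mono) auto
    moreover have "E' \<subseteq> edges G" using less.prems(1) by (auto simp: E'_def)
    ultimately have IH: "finite E'" "card E' < card (V - {v})"
      using less.hyps[of "V - {v}" E'] less.prems(2) E' by auto
    have "card E \<le> card (insert f E')" using sub IH by (intro card_mono) auto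
    also have "\<dots> \<le> Suc (card E')" by (rule card_insert_le_m1) (use IH in auto)
    finally have "card E \<le> Suc (card E')" .
    moreover have "card (V - {v}) < card V" by fact
    ultimately show ?thesis using IH sub by (auto intro: finite_subset)
  qed
qed

lemma wtree_card_edges:
  assumes "wtree G"
  shows "card (edges G) \<le> nverts G - 1"
proof -
  have "card (edges G) < card {..<nverts G}"
    using assms acyclic_card_edges_less[of G "edges G" "{..<nverts G}"]
    unfolding wtree_def wf_wgraph_def by auto
  then show ?thesis by simp
qed

section \<open>Short cycles and pairwise intersecting edges\<close>

lemma acyclic_no_triangle:
  assumes "\<nexists>p. wgraph_cycle G p" "distinct [a, b, c]"
    and "{a, b} \<in> edges G" "{b, c} \<in> edges G"
  shows "{c, a} \<notin> edges G"
proof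
  assume ca: "{c, a} \<in> edges G"
  have "{[a, b, c] ! i, [a, b, c] ! ((i + 1) mod 3)} \<in> edges G" if "i < 3" for i
  proof -
    from that have "i = 0 \<or> i = 1 \<or> i = 2" by linarith
    then show ?thesis using assms(3-) ca by (elim disjE) simp_all
  qed
  then have "wgraph_cycle G [a, b, c]" using assms(2) by (simp add: wgraph_cycle_def)
  with assms show False by blast
qed

lemma acyclic_no_quadrangle:
  assumes "\<nexists>p. wgraph_cycle G p" "distinct [a, b, c, d]"
    and "{a, b} \<in> edges G" "{b, c} \<in> edges G" "{c, d} \<in> edges G"
  shows "{d, a} \<notin> edges G"
proof
  assume da: "{d, a} \<in> edges G"
  have "{[a, b, c, d] ! i, [a, b, c, d] ! ((i + 1) mod 4)} \<in> edges G" if "i < 4" for i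
  proof -
    from that have "i = 0 \<or> i = 1 \<or> i = 2 \<or> i = 3" by linarith
    then show ?thesis using assms(3-) da by (elim disjE) simp_all
  qed
  then have "wgraph_cycle G [a, b, c, d]" using assms(2) by (simp add: wgraph_cycle_def)
  with assms show False by blast
qed

lemma wgraph_connected_neighbour:
  assumes "wgraph_connected G" "u < nverts G" "v < nverts G" "u \<noteq> v"
  obtains w where "{u, w} \<in> edges G"
proof -
  have "(u, v) \<in> {(x, y). {x, y} \<in> edges G}\<^sup>*"
    using assms by (auto simp: wgraph_connected_def)
  then show ?thesis using assms(4) that by (cases rule: converse_rtranclE) auto
qed

text \<open>Pairwise intersecting edges either share a common vertex or contain a triangle, and a
  tree has no triangle.\<close>

lemma intersecting_wtree_is_star:
  assumes T: "wtree T" and n: "nverts T \<ge> 2"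
    and inter: "\<And>e f. e \<in> edges T \<Longrightarrow> f \<in> edges T \<Longrightarrow> e \<inter> f \<noteq> {}"
  shows "is_star T"
proof -
  from T have wf: "wf_wgraph T" and conn: "wgraph_connected T"
    and acyclic: "\<nexists>p. wgraph_cycle T p" by (auto simp: wtree_def)
  \<comment> \<open>By connectedness every vertex v other than c lies on some edge. That edge
    contains c as well, so it is \<open>{c, v}\<close>.\<close>
  have star: "is_star T" if c: "c < nverts T" and all: "\<And>e. e \<in> edges T \<Longrightarrow> c \<in> e" for c
  proof -
    have "edges T = {{c, v} | v. v < nverts T \<and> v \<noteq> c}"
    proof (intro equalityI subsetI)
      fix e assume e: "e \<in> edges T"
      show "e \<in> {{c, v} | v. v < nverts T \<and> v \<noteq> c}"
        by (rule wf_wgraph_edge_atE[OF wf e all[OF e]]) blast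
    next
      fix e assume "e \<in> {{c, v} | v. v < nverts T \<and> v \<noteq> c}"
      then obtain v where v: "e = {c, v}" "v < nverts T" "v \<noteq> c" by blast
      from wgraph_connected_neighbour[OF conn v(2) c v(3)] obtain w where w: "{v, w} \<in> edges T" .
      with all[OF w] v show "e \<in> edges T" by (auto simp: insert_commute)
    qed
    with c show ?thesis unfolding is_star_def by blast
  qed
  have "0 < nverts T" "1 < nverts T" using n by auto
  then obtain b where ab: "{0, b} \<in> edges T"
    using wgraph_connected_neighbour[OF conn, of 0 1] by (metis zero_neq_one)
  note ab' = wf_wgraph_edge_iff[OF wf ab]
  show ?thesis
  proof (rule ccontr)
    assume not_star: "\<not> is_star T"
    with star[OF ab'(1)] obtain f where f: "f \<in> edges T" "0 \<notin> f" by blast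
    from not_star star[OF ab'(2)] obtain g where g: "g \<in> edges T" "b \<notin> g" by blast
    from inter[OF ab f(1)] f(2) have "b \<in> f" by auto
    then obtain c where c: "f = {b, c}" "b \<noteq> c"
      by (rule wf_wgraph_edge_atE[OF wf f(1)])
    from inter[OF ab g(1)] g(2) have "0 \<in> g" by auto
    then obtain d where d: "g = {0, d}" "0 \<noteq> d"
      by (rule wf_wgraph_edge_atE[OF wf g(1)])
    \<comment> \<open>Since 0 is not in \<open>f\<close> and b is not in \<open>g\<close>, their
      common vertex is the other end of each. The three edges then form a triangle on 0, b,
      c.\<close>
    from inter[OF f(1) g(1)] c d f g have "c = d" by auto
    then have "distinct [0, b, c]" "{c, 0} \<in> edges T"
      using c d f g ab' by (auto simp: insert_commute)
    moreover have "{b, c} \<in> edges T" using c f by simp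
    ultimately show False using acyclic_no_triangle[OF acyclic _ ab] by blast
  qed
qed

section \<open>Matching coefficients\<close>

lemma b_coeff_1: "b_coeff 1 G = (\<Sum>e\<in>edges G. (weight G e)\<^sup>2)"
proof -
  have "k_matchings G 1 = (\<lambda>e. {e}) ` edges G"
    by (auto simp: k_matchings_def card_1_singleton_iff)
  then show ?thesis by (simp add: b_coeff_def sum.reindex)
qed

lemma b_coeff_star:
  assumes "is_star G" "k \<ge> 2"
  shows "b_coeff k G = 0"
proof -
  from assms(1) obtain c where c: "\<And>e. e \<in> edges G \<Longrightarrow> c \<in> e"
    unfolding is_star_def by blast
  have "k_matchings G k = {}"
  proof (rule ccontr)
    assume "k_matchings G k \<noteq> {}"
    then obtain M where M: "M \<subseteq> edges G" "card M = k" "pairwise disjnt M"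
      by (auto simp: k_matchings_def)
    have "\<not> card M \<le> Suc 0" using M assms by simp
    then obtain e f where "e \<in> M" "f \<in> M" "e \<noteq> f"
      using card_le_Suc0_iff_eq[of M] card.infinite[of M] by (cases "finite M") auto
    with M c[of e] c[of f] show False unfolding pairwise_def disjnt_def by blast
  qed
  then show ?thesis by (simp add: b_coeff_def)
qed

lemma b_coeff_2_pos:
  assumes wf: "wf_wgraph G" and e: "e \<in> edges G" "f \<in> edges G" "e \<inter> f = {}"
  shows "b_coeff 2 G > 0"
proof -
  have fin: "finite (k_matchings G 2)"
    using finite_edges[OF wf] by (auto simp: k_matchings_def intro: finite_subset[of _ "Pow (edges G)"])
  have "e \<noteq> {}" using wf_wgraph_edgeE[OF wf e(1)] by blast
  with e have "e \<noteq> f" by auto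
  with e have M: "{e, f} \<in> k_matchings G 2"
    by (auto simp: k_matchings_def pairwise_insert disjnt_def)
  have "0 < (\<Prod>e\<in>{e, f}. (weight G e)\<^sup>2)"
    using wf e by (auto simp: wf_wgraph_def)
  also have "\<dots> \<le> b_coeff 2 G"
    unfolding b_coeff_def using M fin by (intro member_le_sum) auto
  finally show ?thesis .
qed

text \<open>Ensures that k = 2 lies in the range of indices that \<open>b_less\<close>
  compares.\<close>

lemma disjoint_edges_nverts:
  assumes wf: "wf_wgraph G" and e: "e \<in> edges G" "f \<in> edges G" "e \<inter> f = {}"
  shows "nverts G \<ge> 4"
proof -
  from wf_wgraph_edgeE[OF wf e(1)] obtain a b where
    ab: "e = {a, b}" "a < nverts G" "b < nverts G" "a \<noteq> b" .
  from wf_wgraph_edgeE[OF wf e(2)] obtain c d where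
    cd: "f = {c, d}" "c < nverts G" "d < nverts G" "c \<noteq> d" .
  have "card {a, b, c, d} = 4" using ab cd e by auto
  moreover have "card {a, b, c, d} \<le> card {..<nverts G}" using ab cd by (intro card_mono) auto
  ultimately show ?thesis by simp
qed

lemma is_star_edges:
  assumes "is_star G"
  obtains c where "c < nverts G" "edges G = (\<lambda>v. {c, v}) ` ({..<nverts G} - {c})"
    "inj_on (\<lambda>v. {c, v}) ({..<nverts G} - {c})"
proof -
  from assms obtain c where c: "c < nverts G" "edges G = {{c, v} | v. v < nverts G \<and> v \<noteq> c}"
    unfolding is_star_def by blast
  have eq: "edges G = (\<lambda>v. {c, v}) ` ({..<nverts G} - {c})" unfolding c(2) by auto
  have inj: "inj_on (\<lambda>v. {c, v}) ({..<nverts G} - {c})"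
    by (auto simp: inj_on_def doubleton_eq_iff)
  show ?thesis by (rule that[OF c(1) eq inj])
qed

lemma star_card_edges:
  assumes "is_star G"
  shows "card (edges G) = nverts G - 1"
  by (rule is_star_edges[OF assms]) (simp add: card_image)

section \<open>Balanced weights\<close>

text \<open>Expansion of (w - r)(w - r - 1), carried out over the integers because subtraction on
  the naturals truncates. For a fixed sum and number of weights, only the last term depends on how
  the weights are distributed.\<close>

lemma sum_squares_deficit:
  fixes w :: "'a \<Rightarrow> nat" and r :: nat
  shows "(\<Sum>e\<in>E. (int (w e))\<^sup>2) = (2 * int r + 1) * int (\<Sum>e\<in>E. w e)
    - int r * (int r + 1) * int (card E)
    + (\<Sum>e\<in>E. (int (w e) - int r) * (int (w e) - int r - 1))"
proof -
  have "(\<Sum>e\<in>E. (int (w e) - int r) * (int (w e) - int r - 1)) =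
      (\<Sum>e\<in>E. (int (w e))\<^sup>2 - (2 * int r + 1) * int (w e) + int r * (int r + 1))"
    by (intro sum.cong refl) (simp add: algebra_simps power2_eq_square)
  then show ?thesis
    by (simp add: sum.distrib sum_subtractf sum_distrib_left)
qed

lemma prod_consecutive_nonneg: "0 \<le> x * (x - 1)" for x :: int
  by (cases "x \<le> 0") (auto simp: zero_le_mult_iff)

text \<open>In \<open>sum_squares_deficit\<close> the last term is nonnegative and vanishes for w'.
  A smaller number of summands also increases the sum of squares. Equality therefore forces equal
  cardinalities and values r or r + 1 only.\<close>

lemma as_equal_as_possible_minimises_sum_squares:
  fixes w :: "'a \<Rightarrow> nat" and w' :: "'b \<Rightarrow> nat"
  assumes fin: "finite F" and F: "F \<noteq> {}" and bal: "as_equal_as_possible w' F"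
    and E: "finite E" "card E \<le> card F" and sum: "(\<Sum>e\<in>E. w e) = (\<Sum>e\<in>F. w' e)"
    and ge: "(\<Sum>e\<in>F. w' e) \<ge> card F"
  shows "(\<Sum>e\<in>F. (w' e)\<^sup>2) \<le> (\<Sum>e\<in>E. (w e)\<^sup>2)"
    and "(\<Sum>e\<in>F. (w' e)\<^sup>2) = (\<Sum>e\<in>E. (w e)\<^sup>2) \<Longrightarrow> as_equal_as_possible w E"
proof -
  define m where "m = (\<Sum>e\<in>F. w' e)"
  define r where "r = m div card F"
  let ?d = "\<lambda>w e. (int (w e) - int r) * (int (w e) - int r - 1)"
  have "card F > 0" using fin F by (simp add: card_gt_0_iff)
  \<comment> \<open>Makes the coefficient of the cardinality strictly positive, so that equal sums
    of squares imply \<open>card E = card F\<close>.\<close>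
  then have "r \<ge> 1" using ge unfolding r_def m_def by (simp add: Suc_le_eq div_greater_zero_iff)
  then have r: "int r * (int r + 1) > 0" by simp
  have nonneg: "?d w e \<ge> 0" for e using prod_consecutive_nonneg .
  have dF: "(\<Sum>e\<in>F. ?d w' e) = 0"
    using bal by (intro sum.neutral) (auto simp: as_equal_as_possible_def Let_def r_def m_def)
  have eqF: "int (\<Sum>e\<in>F. (w' e)\<^sup>2) = (2 * int r + 1) * int m - int r * (int r + 1) * int (card F)"
    using sum_squares_deficit[of w' F r] dF by (simp add: m_def)
  have eqE: "int (\<Sum>e\<in>E. (w e)\<^sup>2) = (2 * int r + 1) * int m - int r * (int r + 1) * int (card E)
      + (\<Sum>e\<in>E. ?d w e)"
    using sum_squares_deficit[of w E r] sum by (simp add: m_def)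
  have dE: "(\<Sum>e\<in>E. ?d w e) \<ge> 0" by (intro sum_nonneg nonneg)
  have le: "int r * (int r + 1) * int (card E) \<le> int r * (int r + 1) * int (card F)"
    using E r by (intro mult_left_mono) auto
  show "(\<Sum>e\<in>F. (w' e)\<^sup>2) \<le> (\<Sum>e\<in>E. (w e)\<^sup>2)"
    using eqE eqF dE le by linarith
  assume eq: "(\<Sum>e\<in>F. (w' e)\<^sup>2) = (\<Sum>e\<in>E. (w e)\<^sup>2)"
  then have "(\<Sum>e\<in>E. ?d w e) = 0"
    and "int r * (int r + 1) * int (card E) = int r * (int r + 1) * int (card F)"
    using eqE eqF dE le by linarith+
  then have "\<forall>e\<in>E. ?d w e = 0" and card: "card E = card F"
    using E nonneg r by (auto simp: sum_nonneg_eq_0_iff)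
  then have "\<forall>e\<in>E. w e = r \<or> w e = r + 1" by auto
  then show "as_equal_as_possible w E"
    using card sum by (auto simp: as_equal_as_possible_def Let_def r_def m_def)
qed

lemma sum_two_valued:
  fixes u :: "'a \<Rightarrow> nat"
  assumes "finite I" "\<forall>i\<in>I. u i = r \<or> u i = r + 1"
  shows "(\<Sum>i\<in>I. u i) = r * card I + card {i \<in> I. u i = r + 1}"
proof -
  have "(\<Sum>i\<in>I. u i) = (\<Sum>i\<in>I. r + (if u i = r + 1 then 1 else 0))"
    using assms by (intro sum.cong) auto
  also have "\<dots> = r * card I + card {i \<in> I. u i = r + 1}"
    using assms(1) by (simp add: sum.distrib sum.If_cases Int_def)
  finally show ?thesis .
qed

text \<open>Sum and cardinality determine r and the number of entries r + 1, so the entries r + 1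
  and the entries r can be matched separately.\<close>

lemma as_equal_as_possible_bij:
  assumes fin: "finite I" "finite J" and card: "card I = card J"
    and sum: "(\<Sum>i\<in>I. u i) = (\<Sum>j\<in>J. u' j)"
    and "as_equal_as_possible u I" "as_equal_as_possible u' J"
  obtains g where "bij_betw g I J" "\<And>i. i \<in> I \<Longrightarrow> u' (g i) = u i"
proof -
  define r where "r = (\<Sum>i\<in>I. u i) div card I"
  have u: "\<forall>i\<in>I. u i = r \<or> u i = r + 1" and u': "\<forall>j\<in>J. u' j = r \<or> u' j = r + 1"
    using assms unfolding as_equal_as_possible_def Let_def r_def by auto
  let ?A = "{i \<in> I. u i = r + 1}" and ?A' = "{j \<in> J. u' j = r + 1}"
  have cA: "card ?A = card ?A'"
    using sum_two_valued[OF fin(1) u] sum_two_valued[OF fin(2) u'] sum card by simp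
  have cB: "card (I - ?A) = card (J - ?A')"
    using cA card fin by (simp add: card_Diff_subset)
  obtain g where g: "bij_betw g ?A ?A'"
    using finite_same_card_bij[OF _ _ cA] fin by auto
  obtain h where h: "bij_betw h (I - ?A) (J - ?A')"
    using finite_same_card_bij[OF _ _ cB] fin by auto
  define f where "f i = (if i \<in> ?A then g i else h i)" for i
  have f1: "bij_betw f ?A ?A'" using g by (rule bij_betw_cong[THEN iffD1, rotated]) (simp add: f_def)
  have f2: "bij_betw f (I - ?A) (J - ?A')"
    using h by (rule bij_betw_cong[THEN iffD1, rotated]) (auto simp: f_def)
  have "bij_betw f (?A \<union> (I - ?A)) (?A' \<union> (J - ?A'))"
    using f1 f2 by (rule bij_betw_combine) auto
  then have "bij_betw f I J" by (simp add: Un_absorb1 Un_Diff_cancel)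
  moreover have "u' (f i) = u i" if "i \<in> I" for i
  proof (cases "i \<in> ?A")
    case True
    then show ?thesis using bij_betwE[OF f1] by auto
  next
    case False
    then have "f i \<in> J - ?A'" using bij_betwE[OF f2] that by blast
    then show ?thesis using False that u u' by auto
  qed
  ultimately show ?thesis using that by blast
qed

lemma as_equal_as_possible_image:
  assumes "inj_on h I"
  shows "as_equal_as_possible w (h ` I) \<longleftrightarrow> as_equal_as_possible (\<lambda>i. w (h i)) I"
  using assms by (simp add: as_equal_as_possible_def sum.reindex card_image)

text \<open>Edges of a star correspond to its leaves. A bijection of the leaves that preserves
  weights extends to an isomorphism by sending centre to centre.\<close>

lemma balanced_stars_iso:
  assumes "is_star G" "is_star H" and n: "nverts G = nverts H"
    and "(\<Sum>e\<in>edges G. weight G e) = (\<Sum>e\<in>edges H. weight H e)"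
    and "as_equal_as_possible (weight G) (edges G)" "as_equal_as_possible (weight H) (edges H)"
  shows "wgraph_iso G H"
proof -
  obtain c where c: "c < nverts G" and G: "edges G = (\<lambda>v. {c, v}) ` ({..<nverts G} - {c})"
    and injG: "inj_on (\<lambda>v. {c, v}) ({..<nverts G} - {c})"
    by (rule is_star_edges[OF assms(1)])
  obtain d where d: "d < nverts H" and H: "edges H = (\<lambda>v. {d, v}) ` ({..<nverts H} - {d})"
    and injH: "inj_on (\<lambda>v. {d, v}) ({..<nverts H} - {d})"
    by (rule is_star_edges[OF assms(2)])
  let ?I = "{..<nverts G} - {c}" and ?J = "{..<nverts H} - {d}"
  obtain g where g: "bij_betw g ?I ?J"
    and gw: "\<And>v. v \<in> ?I \<Longrightarrow> weight H {d, g v} = weight G {c, v}"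
  proof (rule as_equal_as_possible_bij[of ?I ?J "\<lambda>v. weight G {c, v}" "\<lambda>v. weight H {d, v}"])
    show "card ?I = card ?J" using c d n by simp
    show "(\<Sum>i\<in>?I. weight G {c, i}) = (\<Sum>j\<in>?J. weight H {d, j})"
      using assms(4) by (simp add: G H sum.reindex[OF injG] sum.reindex[OF injH])
    show "as_equal_as_possible (\<lambda>v. weight G {c, v}) ?I"
      using assms(5) as_equal_as_possible_image[OF injG] by (simp add: G)
    show "as_equal_as_possible (\<lambda>v. weight H {d, v}) ?J"
      using assms(6) as_equal_as_possible_image[OF injH] by (simp add: H)
  qed auto
  define f where "f = g(c := d)"
  have fc: "f c = d" and fv: "\<And>v. v \<in> ?I \<Longrightarrow> f v = g v" by (auto simp: f_def)
  have "bij_betw f ?I ?J" using g by (rule bij_betw_cong[THEN iffD1, rotated]) (auto simp: f_def)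
  moreover have "bij_betw f {c} {d}" by (simp add: fc bij_betw_def)
  ultimately have "bij_betw f ({c} \<union> ?I) ({d} \<union> ?J)" by (intro bij_betw_combine) auto
  moreover have "{c} \<union> ?I = {..<nverts G}" "{d} \<union> ?J = {..<nverts H}" using c d by auto
  ultimately have "bij_betw f {..<nverts G} {..<nverts H}" by simp
  moreover have "(\<lambda>e. f ` e) ` edges G = edges H"
  proof -
    have "(\<lambda>e. f ` e) ` edges G = (\<lambda>v. {d, g v}) ` ?I"
      unfolding G image_image by (intro image_cong refl) (auto simp: fc fv)
    also have "\<dots> = (\<lambda>v. {d, v}) ` (g ` ?I)" by (simp add: image_image)
    also have "g ` ?I = ?J" using g by (simp add: bij_betw_def)
    finally show ?thesis by (simp add: H)
  qed
  moreover have "\<forall>e\<in>edges G. weight H (f ` e) = weight G e"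
    using gw fv by (auto simp: G fc)
  ultimately show ?thesis unfolding wgraph_iso_def by blast
qed

section \<open>Bounds on the energy\<close>

text \<open>Each edge is counted twice, once for each ordering of its ends. Writing an entry as a
  sum over all edges with an indicator lets the summations be exchanged.\<close>

lemma sum_adj_squares:
  assumes wf: "wf_wgraph G"
  shows "(\<Sum>i<nverts G. \<Sum>j<nverts G. (adj G i j)\<^sup>2) = 2 * real (b_coeff 1 G)"
proof -
  let ?V = "{..<nverts G}"
  have "(\<Sum>i\<in>?V. \<Sum>j\<in>?V. (adj G i j)\<^sup>2) =
      (\<Sum>i\<in>?V. \<Sum>j\<in>?V. \<Sum>e\<in>edges G. if {i, j} = e then (real (weight G e))\<^sup>2 else 0)"
    using finite_edges[OF wf] by (intro sum.cong refl) (simp add: adj_def)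
  also have "\<dots> = (\<Sum>p\<in>?V \<times> ?V. \<Sum>e\<in>edges G.
      if {fst p, snd p} = e then (real (weight G e))\<^sup>2 else 0)"
    using sum.cartesian_product[of "\<lambda>i j. \<Sum>e\<in>edges G.
      if {i, j} = e then (real (weight G e))\<^sup>2 else 0" ?V ?V]
    by (simp only: case_prod_unfold)
  also have "\<dots> = (\<Sum>e\<in>edges G. \<Sum>p\<in>?V \<times> ?V.
      if {fst p, snd p} = e then (real (weight G e))\<^sup>2 else 0)"
    by (rule sum.swap)
  also have "\<dots> = (\<Sum>e\<in>edges G. 2 * (real (weight G e))\<^sup>2)"
  proof (intro sum.cong refl)
    fix e assume "e \<in> edges G"
    then obtain u v where e: "e = {u, v}" "u < nverts G" "v < nverts G" "u \<noteq> v"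
      by (rule wf_wgraph_edgeE[OF wf])
    have "{p \<in> ?V \<times> ?V. {fst p, snd p} = e} = {(u, v), (v, u)}"
      using e by (auto simp: doubleton_eq_iff)
    then have "card {p \<in> ?V \<times> ?V. {fst p, snd p} = e} = 2" using e by simp
    then show "(\<Sum>p\<in>?V \<times> ?V. if {fst p, snd p} = e then (real (weight G e))\<^sup>2 else 0) =
        2 * (real (weight G e))\<^sup>2"
      by (simp add: sum.If_cases Int_def)
  qed
  also have "\<dots> = 2 * real (b_coeff 1 G)"
    unfolding b_coeff_1 by (simp add: sum_distrib_left)
  finally show ?thesis .
qed

text \<open>Inclusion and exclusion: rows and columns i and j are removed, and the entries (i, j)
  and (j, i), removed twice, are added back. The diagonal contributes nothing.\<close>

lemma symmetric_sum_off_pair: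
  fixes x :: "'a \<Rightarrow> 'a \<Rightarrow> real"
  assumes V: "finite V" and sym: "\<And>i j. x i j = x j i" and diag: "\<And>i. x i i = 0"
    and ij: "i \<in> V" "j \<in> V" "i \<noteq> j"
  shows "(\<Sum>k\<in>V - {i, j}. \<Sum>l\<in>V - {i, j}. x k l) =
    (\<Sum>k\<in>V. \<Sum>l\<in>V. x k l) - 2 * (\<Sum>l\<in>V. x i l) - 2 * (\<Sum>l\<in>V. x j l) + 2 * x i j"
proof -
  have minus: "(\<Sum>k\<in>V - {i, j}. f k) = (\<Sum>k\<in>V. f k) - f i - f j" for f :: "'a \<Rightarrow> real"
    using V ij by (simp add: sum_diff)
  have "(\<Sum>k\<in>V. x k i) = (\<Sum>l\<in>V. x i l)" "(\<Sum>k\<in>V. x k j) = (\<Sum>l\<in>V. x j l)"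
    using sym by (intro sum.cong refl; simp)+
  then show ?thesis
    using sym[of i j] by (simp add: minus sum_subtractf diag)
qed

text \<open>
  The difference of the two sides is the sum of \<open>x i j * x k l\<close> over all \<open>i\<close>, \<open>j\<close>, \<open>k\<close>, \<open>l\<close> with
  \<open>{i, j}\<close> and \<open>{k, l}\<close> disjoint.
\<close>

lemma sum_row_squares_bound:
  fixes x :: "'a \<Rightarrow> 'a \<Rightarrow> real"
  assumes V: "finite V" and sym: "\<And>i j. x i j = x j i" and diag: "\<And>i. x i i = 0"
    and nonneg: "\<And>i j. x i j \<ge> 0"
  defines "d \<equiv> \<lambda>i. \<Sum>j\<in>V. x i j"
  shows "4 * (\<Sum>i\<in>V. (d i)\<^sup>2) - 2 * (\<Sum>i\<in>V. \<Sum>j\<in>V. (x i j)\<^sup>2) \<le> (\<Sum>i\<in>V. d i)\<^sup>2"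
    and "\<lbrakk>a \<in> V; b \<in> V; c \<in> V; e \<in> V; {a, b} \<inter> {c, e} = {}; x a b > 0; x c e > 0\<rbrakk> \<Longrightarrow>
      4 * (\<Sum>i\<in>V. (d i)\<^sup>2) - 2 * (\<Sum>i\<in>V. \<Sum>j\<in>V. (x i j)\<^sup>2) < (\<Sum>i\<in>V. d i)\<^sup>2"
proof -
  define D where "D = (\<Sum>i\<in>V. d i)"
  \<comment> \<open>The total of all entries whose two indices avoid i and j; the claimed difference
    is the sum of \<open>x i j * g i j\<close>.\<close>
  define g where "g i j = (\<Sum>k\<in>V - {i, j}. \<Sum>l\<in>V - {i, j}. x k l)" for i j
  have g_nonneg: "g i j \<ge> 0" for i j unfolding g_def by (intro sum_nonneg nonneg)
  have g: "x i j * g i j = x i j * D - 2 * (x i j * d i) - 2 * (x i j * d j) + 2 * (x i j)\<^sup>2"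
    if "i \<in> V" "j \<in> V" for i j
  proof (cases "i = j")
    case False
    have gij: "g i j = D - 2 * d i - 2 * d j + 2 * x i j"
      unfolding g_def D_def d_def by (rule symmetric_sum_off_pair[OF V sym diag that False])
    show ?thesis unfolding gij by (simp add: algebra_simps power2_eq_square)
  qed (simp add: diag)
  have di: "(\<Sum>i\<in>V. \<Sum>j\<in>V. x i j * d i) = (\<Sum>i\<in>V. (d i)\<^sup>2)"
    by (simp add: d_def power2_eq_square sum_distrib_right)
  have "(\<Sum>i\<in>V. \<Sum>j\<in>V. x i j * d j) = (\<Sum>j\<in>V. \<Sum>i\<in>V. x j i * d j)"
    by (subst sum.swap) (simp add: sym)
  then have dj: "(\<Sum>i\<in>V. \<Sum>j\<in>V. x i j * d j) = (\<Sum>i\<in>V. (d i)\<^sup>2)" using di by simp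
  have "(\<Sum>i\<in>V. \<Sum>j\<in>V. x i j * D) = D * D"
    by (simp add: D_def d_def sum_distrib_right)
  then have total: "(\<Sum>i\<in>V. \<Sum>j\<in>V. x i j * g i j) =
      D\<^sup>2 - 4 * (\<Sum>i\<in>V. (d i)\<^sup>2) + 2 * (\<Sum>i\<in>V. \<Sum>j\<in>V. (x i j)\<^sup>2)"
    by (simp add: g sum.distrib sum_subtractf sum_distrib_left[symmetric] di dj power2_eq_square)
  have "0 \<le> (\<Sum>i\<in>V. \<Sum>j\<in>V. x i j * g i j)"
    by (intro sum_nonneg mult_nonneg_nonneg nonneg g_nonneg)
  with total show "4 * (\<Sum>i\<in>V. (d i)\<^sup>2) - 2 * (\<Sum>i\<in>V. \<Sum>j\<in>V. (x i j)\<^sup>2) \<le> (\<Sum>i\<in>V. d i)\<^sup>2"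
    unfolding D_def by linarith
  assume *: "a \<in> V" "b \<in> V" "c \<in> V" "e \<in> V" "{a, b} \<inter> {c, e} = {}" "x a b > 0" "x c e > 0"
  have mem: "f k l \<le> (\<Sum>i\<in>A. \<Sum>j\<in>A. f i j)"
    if "finite A" "k \<in> A" "l \<in> A" "\<And>i j. f i j \<ge> 0" for A k l and f :: "'a \<Rightarrow> 'a \<Rightarrow> real"
  proof -
    have "f k l \<le> (\<Sum>j\<in>A. f k j)" using that by (intro member_le_sum) auto
    also have "\<dots> \<le> (\<Sum>i\<in>A. \<Sum>j\<in>A. f i j)"
      using that by (intro member_le_sum[of k A "\<lambda>i. \<Sum>j\<in>A. f i j"] sum_nonneg) auto
    finally show ?thesis .
  qed
  \<comment> \<open>The pair (c, e) avoids a and b, so \<open>x c e\<close> is a summand of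
    \<open>g a b\<close>, and the difference contains the positive term
    \<open>x a b * g a b\<close>.\<close>
  have "x c e \<le> g a b" unfolding g_def using * V nonneg by (intro mem) auto
  then have "0 < x a b * g a b" using * by simp
  also have "\<dots> \<le> (\<Sum>i\<in>V. \<Sum>j\<in>V. x i j * g i j)"
    using * V nonneg g_nonneg by (intro mem[of V a b "\<lambda>i j. x i j * g i j"]) auto
  finally show "4 * (\<Sum>i\<in>V. (d i)\<^sup>2) - 2 * (\<Sum>i\<in>V. \<Sum>j\<in>V. (x i j)\<^sup>2) < (\<Sum>i\<in>V. d i)\<^sup>2"
    using total unfolding D_def by linarith
qed

text \<open>All cross terms of the expanded square vanish.\<close>

lemma sum_square_at_most_one_nonzero:
  fixes f :: "'a \<Rightarrow> real"
  assumes "finite A" "\<And>k l. k \<in> A \<Longrightarrow> l \<in> A \<Longrightarrow> f k \<noteq> 0 \<Longrightarrow> f l \<noteq> 0 \<Longrightarrow> k = l"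
  shows "(\<Sum>k\<in>A. f k)\<^sup>2 = (\<Sum>k\<in>A. (f k)\<^sup>2)"
proof (cases "\<exists>k\<in>A. f k \<noteq> 0")
  case True
  then obtain k where k: "k \<in> A" "f k \<noteq> 0" by blast
  with assms have z: "f l = 0" if "l \<in> A - {k}" for l using that by blast
  show ?thesis using assms(1) k z by (simp add: sum.remove[of A k])
qed simp

text \<open>
  Without quadrangles, two distinct vertices have at most one common neighbour, so that the
  off-diagonal entries of the squared adjacency matrix have at most one nonzero summand.
\<close>

lemma acyclic_sum_fourth_powers:
  assumes wf: "wf_wgraph G" and acyclic: "\<nexists>p. wgraph_cycle G p"
  defines "V \<equiv> {..<nverts G}" and "x \<equiv> \<lambda>i j. (adj G i j)\<^sup>2"
  shows "(\<Sum>i\<in>V. \<Sum>j\<in>V. (\<Sum>k\<in>V. adj G i k * adj G k j)\<^sup>2) =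
    2 * (\<Sum>i\<in>V. (\<Sum>j\<in>V. x i j)\<^sup>2) - (\<Sum>i\<in>V. \<Sum>j\<in>V. (x i j)\<^sup>2)"
proof -
  have V: "finite V" by (simp add: V_def)
  define d where "d i = (\<Sum>j\<in>V. x i j)" for i
  have nz: "{i, j} \<in> edges G \<and> i \<noteq> j" if "adj G i j \<noteq> 0" for i j
    using that wf_wgraph_edge_iff[OF wf, of i j] by (auto simp: adj_def split: if_splits)
  have off: "(\<Sum>k\<in>V. adj G i k * adj G k j)\<^sup>2 = (\<Sum>k\<in>V. x i k * x k j)" if "i \<noteq> j" for i j
  proof -
    have "k = l" if "adj G i k * adj G k j \<noteq> 0" "adj G i l * adj G l j \<noteq> 0" for k l
    proof (rule ccontr)
      assume "k \<noteq> l"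
      with that \<open>i \<noteq> j\<close> nz[of i k] nz[of k j] nz[of i l] nz[of l j]
      have "distinct [i, k, j, l]" "{i, k} \<in> edges G" "{k, j} \<in> edges G" "{j, l} \<in> edges G"
        "{l, i} \<in> edges G"
        by (auto simp: insert_commute)
      with acyclic_no_quadrangle[OF acyclic] show False by blast
    qed
    then show ?thesis
      by (subst sum_square_at_most_one_nonzero[OF V]) (auto simp: x_def power_mult_distrib)
  qed
  have on: "(\<Sum>k\<in>V. adj G i k * adj G k i) = d i" for i
    by (simp add: d_def x_def adj_commute power2_eq_square)
  \<comment> \<open>The diagonal position j = i contributes \<open>(d i)\<^sup>2\<close>. Extending
    the remaining sum to all j adds the squares of row i of x, which are subtracted again.\<close>
  have row: "(\<Sum>j\<in>V. (\<Sum>k\<in>V. adj G i k * adj G k j)\<^sup>2) =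
      (d i)\<^sup>2 + (\<Sum>j\<in>V. \<Sum>k\<in>V. x i k * x k j) - (\<Sum>k\<in>V. (x i k)\<^sup>2)" if "i \<in> V" for i
  proof -
    have "(\<Sum>j\<in>V. (\<Sum>k\<in>V. adj G i k * adj G k j)\<^sup>2) =
        (d i)\<^sup>2 + (\<Sum>j\<in>V - {i}. \<Sum>k\<in>V. x i k * x k j)"
      using V that
      by (simp add: sum.remove[of V i "\<lambda>j. (\<Sum>k\<in>V. adj G i k * adj G k j)\<^sup>2"] on off)
    moreover have "(\<Sum>j\<in>V. \<Sum>k\<in>V. x i k * x k j) =
        (\<Sum>k\<in>V. (x i k)\<^sup>2) + (\<Sum>j\<in>V - {i}. \<Sum>k\<in>V. x i k * x k j)"
      by (subst sum.remove[OF V that]) (simp add: x_def adj_commute power2_eq_square)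
    ultimately show ?thesis by simp
  qed
  have "(\<Sum>i\<in>V. \<Sum>j\<in>V. \<Sum>k\<in>V. x i k * x k j) = (\<Sum>k\<in>V. \<Sum>i\<in>V. \<Sum>j\<in>V. x i k * x k j)"
    by (subst (2) sum.swap, subst sum.swap) simp
  also have "\<dots> = (\<Sum>k\<in>V. (d k)\<^sup>2)"
    by (simp add: d_def x_def adj_commute power2_eq_square sum_product)
  finally show ?thesis
    unfolding d_def[symmetric] by (simp add: row sum.distrib sum_subtractf)
qed

text \<open>For the squared entries x, twice \<open>q\<close> is the left side of
  \<open>sum_row_squares_bound\<close>, and the right side is the square of
  \<open>2 * b_coeff 1 G\<close>. Two disjoint edges make that bound strict.\<close>

lemma acyclic_trace_fourth_power:
  assumes wf: "wf_wgraph G" and acyclic: "\<nexists>p. wgraph_cycle G p"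
  defines "q \<equiv> \<Sum>i<nverts G. \<Sum>j<nverts G. (\<Sum>k<nverts G. adj G i k * adj G k j)\<^sup>2"
  shows "q \<le> 2 * (real (b_coeff 1 G))\<^sup>2"
    and "\<lbrakk>e \<in> edges G; f \<in> edges G; e \<inter> f = {}\<rbrakk> \<Longrightarrow> q < 2 * (real (b_coeff 1 G))\<^sup>2"
proof -
  let ?V = "{..<nverts G}"
  let ?x = "\<lambda>i j. (adj G i j)\<^sup>2"
  have diag: "?x i i = 0" for i
    using wf_wgraph_edge_iff[OF wf, of i i] by (auto simp: adj_def)
  have sym: "?x i j = ?x j i" for i j by (simp add: adj_commute)
  have pos: "?x i j > 0" if "{i, j} \<in> edges G" for i j
    using that wf by (simp add: adj_def wf_wgraph_def)
  note bound = sum_row_squares_bound[of ?V ?x, OF finite_lessThan sym diag]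
  have D: "(\<Sum>i\<in>?V. \<Sum>j\<in>?V. ?x i j) = 2 * real (b_coeff 1 G)" by (rule sum_adj_squares[OF wf])
  have q: "2 * q = 4 * (\<Sum>i\<in>?V. (\<Sum>j\<in>?V. ?x i j)\<^sup>2) - 2 * (\<Sum>i\<in>?V. \<Sum>j\<in>?V. (?x i j)\<^sup>2)"
    unfolding q_def acyclic_sum_fourth_powers[OF wf acyclic] by simp
  show "q \<le> 2 * (real (b_coeff 1 G))\<^sup>2"
    using bound(1) q by (simp add: D power_mult_distrib)
  assume e: "e \<in> edges G" "f \<in> edges G" "e \<inter> f = {}"
  obtain a b where ab: "e = {a, b}" "a < nverts G" "b < nverts G" by (rule wf_wgraph_edgeE[OF wf e(1)])
  obtain c d where cd: "f = {c, d}" "c < nverts G" "d < nverts G" by (rule wf_wgraph_edgeE[OF wf e(2)])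
  show "q < 2 * (real (b_coeff 1 G))\<^sup>2"
    using bound(2)[of a b c d] q pos[of a b] pos[of c d] ab cd e by (simp add: D power_mult_distrib)
qed

text \<open>
  The bound \<open>2 s\<^sup>3 a \<ge> 3 s\<^sup>2 a\<^sup>2 - a\<^sup>4\<close> for \<open>a \<ge> 0\<close> is tangent at \<open>a = s\<close>, the absolute
  value that all nonzero eigenvalues have in the extremal case. Summed over the spectrum it bounds the
  energy by the traces of the second and fourth powers of the adjacency matrix.
\<close>

lemma energy_lower_bound:
  assumes wf: "wf_wgraph G" and acyclic: "\<nexists>p. wgraph_cycle G p" and pos: "b_coeff 1 G > 0"
  shows "2 * sqrt (b_coeff 1 G) \<le> energy G"
    and "\<lbrakk>e \<in> edges G; f \<in> edges G; e \<inter> f = {}\<rbrakk> \<Longrightarrow> 2 * sqrt (b_coeff 1 G) < energy G"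
proof -
  define s where "s = sqrt (b_coeff 1 G)"
  have s: "s > 0" "s\<^sup>2 = real (b_coeff 1 G)" using pos by (simp_all add: s_def)
  obtain ls where E: "energy G = (\<Sum>l\<leftarrow>ls. \<bar>l\<bar>)"
    and l2: "(\<Sum>l\<leftarrow>ls. l\<^sup>2) = (\<Sum>i<nverts G. \<Sum>j<nverts G. (adj G i j)\<^sup>2)"
    and l4: "(\<Sum>l\<leftarrow>ls. l ^ 4) =
      (\<Sum>i<nverts G. \<Sum>j<nverts G. (\<Sum>k<nverts G. adj G i k * adj G k j)\<^sup>2)"
    by (rule energy_real_spectrum)
  have l2: "(\<Sum>l\<leftarrow>ls. l\<^sup>2) = 2 * s\<^sup>2" using l2 sum_adj_squares[OF wf] s by simp
  have pt: "3 * s\<^sup>2 * l\<^sup>2 - l ^ 4 \<le> 2 * s ^ 3 * \<bar>l\<bar>" for l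
  proof -
    \<comment> \<open>The difference of the two sides of the tangent bound, with its double root at
      s made visible; the other factors are nonnegative for a \<ge> 0.\<close>
    have factor: "a * ((a - s)\<^sup>2 * (a + 2 * s)) = 2 * s ^ 3 * a - 3 * s\<^sup>2 * a\<^sup>2 + a ^ 4"
      for a :: real
      by (simp add: algebra_simps power2_eq_square power3_eq_cube power4_eq_xxxx)
    have "0 \<le> \<bar>l\<bar> * ((\<bar>l\<bar> - s)\<^sup>2 * (\<bar>l\<bar> + 2 * s))" using s by simp
    also note factor
    also have "\<bar>l\<bar> ^ 4 = l ^ 4" by (simp add: power_even_abs)
    finally show ?thesis by simp
  qed
  have "3 * s\<^sup>2 * (\<Sum>l\<leftarrow>ls. l\<^sup>2) - (\<Sum>l\<leftarrow>ls. l ^ 4) \<le> 2 * s ^ 3 * (\<Sum>l\<leftarrow>ls. \<bar>l\<bar>)"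
  proof (induction ls)
    case (Cons l ls)
    with pt[of l] show ?case by (simp add: algebra_simps)
  qed simp
  then have key: "6 * s ^ 4 - (\<Sum>l\<leftarrow>ls. l ^ 4) \<le> 2 * s ^ 3 * energy G"
    unfolding l2 E by (simp add: power_numeral_reduce mult_ac)
  have s4: "(real (b_coeff 1 G))\<^sup>2 = s ^ 4" using s by (metis power_mult numeral_Bit0 mult_2)
  \<comment> \<open>The fourth moment is at most \<open>2 * s ^ 4\<close>, which leaves
    \<open>4 * s ^ 4\<close> of the \<open>6 * s ^ 4\<close> in \<open>key\<close>.\<close>
  have "2 * s ^ 3 * (2 * s) \<le> 2 * s ^ 3 * energy G"
    using key acyclic_trace_fourth_power(1)[OF wf acyclic] unfolding l4 s4
    by (simp add: power_numeral_reduce mult_ac)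
  then show "2 * sqrt (b_coeff 1 G) \<le> energy G" using s(1) by (simp add: s_def)
  assume ef: "e \<in> edges G" "f \<in> edges G" "e \<inter> f = {}"
  have "2 * s ^ 3 * (2 * s) < 2 * s ^ 3 * energy G"
    using key acyclic_trace_fourth_power(2)[OF wf acyclic ef] unfolding l4 s4
    by (simp add: power_numeral_reduce mult_ac)
  then show "2 * sqrt (b_coeff 1 G) < energy G" using s(1) by (simp add: s_def)
qed

text \<open>Every eigenvalue l has \<open>l\<^sup>2\<close> equal to 0 or to
  \<open>b_coeff 1 G\<close>. In both cases
  \<open>sqrt (b_coeff 1 G) * \<bar>l\<bar> = l\<^sup>2\<close>, so the second moment alone gives
  the energy, without counting multiplicities.\<close>

lemma energy_star:
  assumes wf: "wf_wgraph G" and star: "is_star G" and pos: "b_coeff 1 G > 0"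
  shows "energy G = 2 * sqrt (b_coeff 1 G)"
proof -
  let ?n = "nverts G" and ?b = "real (b_coeff 1 G)"
  obtain c where c: "c < ?n" and edges: "edges G = (\<lambda>v. {c, v}) ` ({..<?n} - {c})"
    and inj: "inj_on (\<lambda>v. {c, v}) ({..<?n} - {c})"
    by (rule is_star_edges[OF star])
  have centre: "c \<in> e" if "e \<in> edges G" for e using that edges by auto
  have off: "adj G i j = 0" if "i \<noteq> c" "j \<noteq> c" for i j
    using that centre[of "{i, j}"] by (auto simp: adj_def)
  have cc: "adj G c c = 0" using wf_wgraph_edge_iff(3)[OF wf, of c c] by (auto simp: adj_def)
  have "?b = (\<Sum>v\<in>{..<?n} - {c}. (real (weight G {c, v}))\<^sup>2)"
    unfolding b_coeff_1 by (simp add: edges sum.reindex[OF inj])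
  also have "\<dots> = (\<Sum>v\<in>{..<?n} - {c}. (adj G c v)\<^sup>2)"
    by (intro sum.cong refl) (simp add: adj_def edges)
  also have "\<dots> = (\<Sum>v<?n. (adj G c v)\<^sup>2)"
    using c cc by (simp add: sum.remove[of "{..<?n}" c])
  finally have b: "?b = (\<Sum>v<?n. (adj G c v)\<^sup>2)" .
  let ?C = "map_mat complex_of_real (adj_matrix G)"
  have ev: "l\<^sup>2 = 0 \<or> l\<^sup>2 = ?b" if "eigenvalue ?C (of_real l)" for l
  proof -
    from that obtain v where v: "v \<in> carrier_vec ?n" "v \<noteq> 0\<^sub>v ?n" "?C *\<^sub>v v = of_real l \<cdot>\<^sub>v v"
      using adj_matrix_carrier[of G] unfolding eigenvalue_def eigenvector_def by auto
    have row: "(\<Sum>j<?n. of_real (adj G i j) * v $ j) = of_real l * v $ i" if "i < ?n" for i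
    proof -
      have "(\<Sum>j<?n. of_real (adj G i j) * v $ j) = (?C *\<^sub>v v) $ i"
        using that v(1) adj_matrix_carrier[of G]
        by (simp add: scalar_prod_def atLeast0LessThan adj_matrix_index)
      then show ?thesis using that v by simp
    qed
    \<comment> \<open>The row of a leaf has its only possibly nonzero entry at the centre.\<close>
    have leaf: "of_real l * v $ i = of_real (adj G i c) * v $ c" if "i < ?n" "i \<noteq> c" for i
    proof -
      have "(\<Sum>j<?n. of_real (adj G i j) * v $ j) = (\<Sum>j\<in>{c}. of_real (adj G i j) * v $ j)"
        using c that off by (intro sum.mono_neutral_right) auto
      then show ?thesis using row[OF that(1)] by simp
    qed
    show ?thesis
    proof (cases "v $ c = 0")
      case True
      obtain i where i: "i < ?n" "v $ i \<noteq> 0" using v(1,2) by (metis carrier_vecD eq_vecI index_zero_vec)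
      then have "l = 0" using leaf[of i] True by auto
      then show ?thesis by simp
    next
      case False
      \<comment> \<open>The centre row is multiplied by l, and the leaf equations then express every
        \<open>l * v $ j\<close> through \<open>v $ c\<close>.\<close>
      have "of_real (l\<^sup>2) * v $ c = of_real l * (of_real l * v $ c)"
        by (simp add: power2_eq_square)
      also have "\<dots> = (\<Sum>j<?n. of_real (adj G c j) * (of_real l * v $ j))"
        by (simp add: row[OF c, symmetric] sum_distrib_left mult_ac)
      also have "\<dots> = (\<Sum>j<?n. of_real ((adj G c j)\<^sup>2) * v $ c)"
      proof (intro sum.cong refl)
        fix j assume "j \<in> {..<?n}"
        then show "of_real (adj G c j) * (of_real l * v $ j) = of_real ((adj G c j)\<^sup>2) * v $ c"
          using leaf[of j] cc by (cases "j = c") (simp_all add: adj_commute power2_eq_square)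
      qed
      also have "\<dots> = of_real ?b * v $ c" unfolding b by (simp add: sum_distrib_right)
      finally have "complex_of_real (l\<^sup>2) = of_real ?b" using False by simp
      then have "l\<^sup>2 = ?b" by (simp only: of_real_eq_iff)
      then show ?thesis ..
    qed
  qed
  obtain ls where E: "energy G = (\<Sum>l\<leftarrow>ls. \<bar>l\<bar>)"
    and l2: "(\<Sum>l\<leftarrow>ls. l\<^sup>2) = (\<Sum>i<?n. \<Sum>j<?n. (adj G i j)\<^sup>2)"
    and evs: "\<And>l. l \<in> set ls \<Longrightarrow> eigenvalue ?C (of_real l)"
    by (rule energy_real_spectrum[of G], rule that)
  have "sqrt ?b * \<bar>l\<bar> = l\<^sup>2" if "l \<in> set ls" for l
    using ev[OF evs[OF that]]
  proof
    assume "l\<^sup>2 = ?b"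
    then have "sqrt ?b = \<bar>l\<bar>" by (metis real_sqrt_abs)
    then show ?thesis by (simp add: power2_eq_square)
  qed simp
  then have "sqrt ?b * energy G = (\<Sum>l\<leftarrow>ls. l\<^sup>2)"
    unfolding E by (simp add: sum_list_const_mult[symmetric] cong: map_cong)
  also have "\<dots> = sqrt ?b * (2 * sqrt ?b)" using l2 sum_adj_squares[OF wf] by simp
  finally show ?thesis using pos by simp
qed

section \<open>Comparison of the balanced star with an arbitrary tree\<close>

lemma wtrees_star_b_coeff_1:
  assumes n: "n \<ge> 2" and m: "m \<ge> n - 1"
    and S: "S \<in> wtrees n m" "is_star S" "as_equal_as_possible (weight S) (edges S)"
    and T: "T \<in> wtrees n m"
  shows "b_coeff 1 S \<le> b_coeff 1 T"
    and "b_coeff 1 S = b_coeff 1 T \<Longrightarrow> as_equal_as_possible (weight T) (edges T)"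
proof -
  have wf: "wf_wgraph S" "wf_wgraph T" and nv: "nverts S = n" "nverts T = n" and T': "wtree T"
    using S T by (auto simp: wtrees_def wtree_def)
  note card = star_card_edges[OF S(2)]
  have "edges S \<noteq> {}" using card n nv by auto
  note min = as_equal_as_possible_minimises_sum_squares[OF finite_edges[OF wf(1)] this S(3)
      finite_edges[OF wf(2)], of "weight T"]
  have "card (edges T) \<le> card (edges S)" using wtree_card_edges[OF T'] card nv by simp
  moreover have "sum (weight T) (edges T) = sum (weight S) (edges S)"
    using S T by (simp add: wtrees_def)
  moreover have "card (edges S) \<le> sum (weight S) (edges S)"
    using S m card nv by (simp add: wtrees_def)
  ultimately show "b_coeff 1 S \<le> b_coeff 1 T"
    and "b_coeff 1 S = b_coeff 1 T \<Longrightarrow> as_equal_as_possible (weight T) (edges T)"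
    using min unfolding b_coeff_1 by blast+
qed

theorem theorem1:
  fixes n m :: nat and S T :: wgraph
  assumes "n \<ge> 2" and "m \<ge> n - 1"
    and "S \<in> wtrees n m" and "is_star S" and "as_equal_as_possible (weight S) (edges S)"
    and "T \<in> wtrees n m" and "\<not> wgraph_iso T S"
  shows "S \<prec>\<^sub>b T \<and> energy S < energy T"
proof -
  have S: "wf_wgraph S" "nverts S = n" and T: "wtree T" "wf_wgraph T" "nverts T = n"
    and acyclic: "\<nexists>p. wgraph_cycle T p"
    and sum: "(\<Sum>e\<in>edges T. weight T e) = (\<Sum>e\<in>edges S. weight S e)"
    using assms(3,6) by (auto simp: wtrees_def wtree_def)
  note b1 = wtrees_star_b_coeff_1[OF assms(1-6)]
  have le: "S \<preceq>\<^sub>b T"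
    unfolding b_le_def
  proof (intro conjI ballI)
    fix k assume "k \<in> {1..nverts S div 2}"
    then have "k = 1 \<or> k \<ge> 2" by auto
    then show "b_coeff k S \<le> b_coeff k T" using b1(1) b_coeff_star[OF assms(4)] by auto
  qed (simp add: S T)
  have "edges S \<noteq> {}" using star_card_edges[OF assms(4)] assms(1) S by auto
  then have pos: "b_coeff 1 S > 0"
    using S(1) finite_edges[OF S(1)] unfolding b_coeff_1
    by (intro sum_pos) (auto simp: wf_wgraph_def)
  then have posT: "b_coeff 1 T > 0" using b1(1) by linarith
  note energyS = energy_star[OF S(1) assms(4) pos]
  note energyT = energy_lower_bound[OF T(2) acyclic posT]
  show ?thesis
  proof (cases "\<exists>e\<in>edges T. \<exists>f\<in>edges T. e \<inter> f = {}")
    case True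
    then obtain e f where ef: "e \<in> edges T" "f \<in> edges T" "e \<inter> f = {}" by blast
    have "2 \<in> {1..nverts S div 2}" using disjoint_edges_nverts[OF T(2) ef] S T by simp
    moreover have "b_coeff 2 S < b_coeff 2 T"
      using b_coeff_star[OF assms(4)] b_coeff_2_pos[OF T(2) ef] by simp
    ultimately have "S \<prec>\<^sub>b T" using le unfolding b_less_def by blast
    moreover have "energy S \<le> 2 * sqrt (b_coeff 1 T)" using energyS b1(1) by simp
    \<comment> \<open>Here \<open>b_coeff 1\<close> may agree for both trees; strictness comes from
      the disjoint edges.\<close>
    with energyT(2)[OF ef] have "energy S < energy T" by linarith
    ultimately show ?thesis by blast
  next
    case False
    then have "is_star T" using intersecting_wtree_is_star[OF T(1)] T assms(1) by auto
    \<comment> \<open>Equality would make T a balanced star of the same order and total weight,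
      hence isomorphic to S.\<close>
    then have "b_coeff 1 S \<noteq> b_coeff 1 T"
      using balanced_stars_iso[of T S] assms S T sum b1(2) by auto
    then have less: "b_coeff 1 S < b_coeff 1 T" using b1(1) by simp
    moreover have "1 \<in> {1..nverts S div 2}" using assms(1) S by simp
    ultimately have "S \<prec>\<^sub>b T" using le unfolding b_less_def by blast
    moreover have "energy S < 2 * sqrt (b_coeff 1 T)" using energyS less by simp
    with energyT(1) have "energy S < energy T" by linarith
    ultimately show ?thesis by blast
  qed
qed

end
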